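(* Let $m$ be a positive integer, $q=2^m$, $n=2m$, let $\xi$ be a primitive element of $\mathbb{F}_q$ and set $\xi^\infty=0$. For $i\in\{\infty\}\cup\mathbb{Z}_{q-1}$ let $\alpha_i\in\mathbb{F}_q$ and $N_i=\{x\in\mathbb{F}_{q^2}: x^q+x=\xi^i\}$. Define $f(x)={\rm Tr}_1^m(\alpha_ix^{q+1})$ if $x\in N_i$, $i\in\{\infty\}\cup\mathbb{Z}_{q-1}$. If $\{\alpha_i^2\xi^{2i}+\alpha_i: i\in\{\infty,0,\dots,q-2\}\}=\mathbb{F}_q$, then $f$ is a bent function on $\mathbb{F}_{q^2}$; moreover, for every $b\in\mathbb{F}_{q^2}$ there is a unique $t\in\{\infty\}\cup\mathbb{Z}_{q-1}$ with $b^q+b=\alpha_t\xi^t+\alpha_t^{2^{-1}}$, and $\widehat f(b)=q(-1)^{\varphi_t(b)}$, where $\varphi_t(b)={\rm Tr}_1^m(\xi^tb)$ if $\alpha_t=0$ and $\varphi_t(b)={\rm Tr}_1^m(\alpha_t^{-1}b^{q+1})+1$ if $\alpha_t\ne0$.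
   Context: ${\rm Tr}_1^k$ is the absolute trace of $\mathbb{F}_{2^k}$; $\alpha^{2^{-1}}$ denotes the square root of $\alpha$ in $\mathbb{F}_q$. Walsh transform $\widehat f(b)=\sum_{x\in\mathbb{F}_{q^2}}(-1)^{f(x)+{\rm Tr}_1^n(bx)}$; $f$ bent iff $|\widehat f(b)|=q$ for all $b$. *)

theory Defs
  imports
    "HOL-Number_Theory.Number_Theory"
    "HOL-Library.Extended_Nat"
    "HOL-Library.Z2"
begin

definition is_subfield :: "'a::field set \<Rightarrow> bool" where
  "is_subfield K \<longleftrightarrow> 0 \<in> K \<and> 1 \<in> K \<and>
     (\<forall>x\<in>K. \<forall>y\<in>K. x + y \<in> K \<and> x * y \<in> K) \<and>
     (\<forall>x\<in>K. - x \<in> K \<and> inverse x \<in> K)"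

definition primitive_element :: "'a::field set \<Rightarrow> 'a \<Rightarrow> bool" where
  "primitive_element K \<xi> \<longleftrightarrow> K - {0} = range (\<lambda>i::nat. \<xi> ^ i)"

definition trace_sum :: "nat \<Rightarrow> 'a::field \<Rightarrow> 'a" where
  "trace_sum k x = (\<Sum>i<k. x ^ (2 ^ i))"

text \<open>
  For a field of characteristic 2 and an \<open>x\<close> in its subfield with \<open>2 ^ k\<close> elements, \<open>trace_sum k x\<close>
  lies in the prime field \<open>{0, 1}\<close> (lemma \<open>trace_sum_01\<close> below). The absolute trace \<open>Tr k x\<close> is this
  element read in the two-element field \<^typ>\<open>bit\<close>. For other \<open>x\<close> it has no meaning.
\<close>

definition Tr :: "nat \<Rightarrow> 'a::field \<Rightarrow> bit" where
  "Tr k x = (if trace_sum k x = 0 then 0 else 1)"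

lemma trace_sum_01:
  fixes x :: "'a::field"
  assumes char: "CHAR('a) = 2" and x: "x ^ (2 ^ k) = x"
  shows "trace_sum k x \<in> {0, 1}"
proof -
  define y where "y i = x ^ (2 ^ i)" for i :: nat
  define s where "s = trace_sum k x"
  have s: "s = (\<Sum>i<k. y i)"
    unfolding s_def trace_sum_def y_def by (rule refl)
  have y_Suc: "y i ^ 2 = y (Suc i)" for i
    unfolding y_def power_Suc2 by (rule power_mult[symmetric])
  have "s ^ 2 = (\<Sum>i<k. y i ^ 2)"
    unfolding s by (rule freshmans_dream_sum) (simp_all only: char two_is_prime_nat)
  also have "\<dots> = (\<Sum>i<k. y (Suc i))"
    unfolding y_Suc by (rule refl)
  also have "\<dots> = s + y k - y 0"
    unfolding s using sum.lessThan_Suc_shift[of y k] sum.lessThan_Suc[of y k] by (simp only: add_diff_cancel_left')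
  also have "\<dots> = s"
    using x by (simp only: y_def power_0 power_one_right add_diff_cancel_right')
  finally have "s * s = s * 1"
    unfolding power2_eq_square by (simp only: mult_1_right)
  then have "s = 0 \<or> s = 1"
    unfolding mult_cancel_left .
  then show ?thesis
    unfolding s_def by blast
qed

definition sign :: "bit \<Rightarrow> int" where
  "sign c = (if c = 0 then 1 else - 1)"

text \<open>
  In the following two definitions, the type \<^typ>\<open>'a\<close> is meant to be the field with \<open>2 ^ n\<close>,
  respectively \<open>2 ^ (2 * m)\<close>, elements.
\<close>

definition walsh :: "nat \<Rightarrow> ('a::finite_field \<Rightarrow> bit) \<Rightarrow> 'a \<Rightarrow> int" where
  "walsh n f b = (\<Sum>x\<in>UNIV. sign (f x + Tr n (b * x)))"

definition bent :: "nat \<Rightarrow> ('a::finite_field \<Rightarrow> bit) \<Rightarrow> bool" where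
  "bent m f \<longleftrightarrow> (\<forall>b. \<bar>walsh (2 * m) f b\<bar> = 2 ^ m)"

definition sqrt_in :: "'a::field set \<Rightarrow> 'a \<Rightarrow> 'a" where
  "sqrt_in K a = (THE r. r \<in> K \<and> r ^ 2 = a)"

text \<open>
  The index set \<open>{\<infinity>} \<union> \<int>\<^bsub>q-1\<^esub>\<close>, with the residues represented by \<open>0, \<dots>, q - 2\<close>. Powers are
  extended by \<open>\<xi>\<^sup>\<infinity> = 0\<close>.
\<close>

definition index_set :: "nat \<Rightarrow> enat set" where
  "index_set q = insert \<infinity> (enat ` {..<q - 1})"

definition epow :: "'a::field \<Rightarrow> enat \<Rightarrow> 'a" where
  "epow \<xi> i = (case i of enat k \<Rightarrow> \<xi> ^ k | \<infinity> \<Rightarrow> 0)"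

definition N_set :: "nat \<Rightarrow> 'a::field \<Rightarrow> enat \<Rightarrow> 'a set" where
  "N_set q \<xi> i = {x. x ^ q + x = epow \<xi> i}"

definition phi :: "nat \<Rightarrow> 'a::field \<Rightarrow> (enat \<Rightarrow> 'a) \<Rightarrow> enat \<Rightarrow> 'a \<Rightarrow> bit" where
  "phi m \<xi> \<alpha> t b =
     (if \<alpha> t = 0 then Tr m (epow \<xi> t * b)
      else Tr m (inverse (\<alpha> t) * b ^ (2 ^ m + 1)) + 1)"

end

theory Submission
  imports Defs "HOL-Computational_Algebra.Polynomial"
begin

text \<open>
  Each \<open>N\<^sub>i\<close> is a coset \<open>z + K\<close> of the subfield \<open>K\<close> with \<open>q\<close> elements, and on it
  \<open>f(z + y) + Tr\<^sub>n(b(z + y))\<close> equals a constant plus \<open>Tr\<^sub>m(d y)\<close> with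
  \<open>d = \<alpha>\<^sub>i \<xi>\<^sup>i + \<alpha>\<^sub>i\<^bsup>1/2\<^esup> + b\<^sup>q + b\<close>. By orthogonality of characters only the cosets with \<open>d = 0\<close>
  contribute to the Walsh coefficient, each of them \<open>q\<close> times a sign. The hypothesis on the \<open>\<alpha>\<^sub>i\<close>
  says that the squares of \<open>\<alpha>\<^sub>i \<xi>\<^sup>i + \<alpha>\<^sub>i\<^bsup>1/2\<^esup>\<close> exhaust \<open>K\<close>; as there are \<open>q\<close> indices,
  these elements run through \<open>K\<close> exactly once, so exactly one coset contributes.
\<close>

section \<open>Signs and sums of characters\<close>

lemma sign_add: "sign (c + d) = sign c * sign d"
  by (cases c; cases d) (simp_all add: sign_def)

text \<open>Translation by \<open>z\<close> permutes \<open>K\<close> and multiplies the sum by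
  \<open>\<chi> z\<close>, which differs from 1; the integers have no zero divisors.\<close>

lemma sum_character_eq_0:
  fixes \<chi> :: "'a::ab_group_add \<Rightarrow> int"
  assumes closed: "\<And>x y. x \<in> K \<Longrightarrow> y \<in> K \<Longrightarrow> x + y \<in> K" "\<And>x. x \<in> K \<Longrightarrow> - x \<in> K"
    and hom: "\<And>x y. x \<in> K \<Longrightarrow> y \<in> K \<Longrightarrow> \<chi> (x + y) = \<chi> x * \<chi> y"
    and z: "z \<in> K" "\<chi> z \<noteq> 1"
  shows "(\<Sum>x\<in>K. \<chi> x) = 0"
proof -
  have minus: "x - z \<in> K" if "x \<in> K" for x
    using closed(1)[OF that closed(2)[OF z(1)]] by simp
  have "(\<Sum>x\<in>K. \<chi> x) = (\<Sum>x\<in>K. \<chi> (x + z))"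
    by (rule sum.reindex_bij_witness[of _ "\<lambda>x. x + z" "\<lambda>x. x - z"])
      (auto intro: minus closed(1) z(1))
  also have "\<dots> = (\<Sum>x\<in>K. \<chi> x) * \<chi> z"
    using z(1) by (simp add: hom sum_distrib_right)
  finally show ?thesis
    using z(2) by (metis mult_cancel_left mult.right_neutral)
qed

section \<open>Traces in characteristic 2, and powers in finite subfields\<close>

lemma trace_sum_0: "trace_sum k (0 :: 'a::field) = 0"
  by (simp add: trace_sum_def power_0_left)

lemma trace_sum_add_left: "trace_sum (j + k) x = trace_sum j x + trace_sum k (x ^ (2 ^ j))"
  by (induction k) (simp_all add: trace_sum_def power_add flip: power_mult)

text \<open>Squaring \<open>x\<close> shifts the exponents by one, so both sides are the sum over
  \<open>i < Suc k\<close>, split off at its first and at its last term.\<close>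

lemma trace_sum_power2: "trace_sum k (x ^ 2) + x = trace_sum k x + x ^ (2 ^ k)"
  using sum.lessThan_Suc_shift[of "\<lambda>i. x ^ (2 ^ i)" k] sum.lessThan_Suc[of "\<lambda>i. x ^ (2 ^ i)" k]
  by (simp add: trace_sum_def add.commute flip: power_mult)

lemma trace_sum_add:
  fixes x y :: "'a::field"
  assumes "CHAR('a) = 2"
  shows "trace_sum k (x + y) = trace_sum k x + trace_sum k y"
proof -
  have "(x + y) ^ (2 ^ i) = x ^ (2 ^ i) + y ^ (2 ^ i)" for i
    by (rule freshmans_dream') (simp_all add: assms)
  then show ?thesis
    by (simp add: trace_sum_def sum.distrib)
qed

lemma Tr_0: "Tr k (0 :: 'a::field) = 0"
  by (simp add: Tr_def trace_sum_0)

lemma Tr_add: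
  fixes x y :: "'a::field"
  assumes char: "CHAR('a) = 2" and "x ^ (2 ^ k) = x" "y ^ (2 ^ k) = y"
  shows "Tr k (x + y) = Tr k x + Tr k y"
proof -
  have "(1 :: 'a) + 1 = 0"
    using minus_CHAR_2[OF char, of 1 1] by simp
  then show ?thesis
    using trace_sum_01[OF char assms(2)] trace_sum_01[OF char assms(3)]
    by (auto simp: Tr_def trace_sum_add[OF char])
qed

lemma Tr_power2:
  fixes x :: "'a::field"
  assumes "x ^ (2 ^ k) = x"
  shows "Tr k (x ^ 2) = Tr k x"
  using trace_sum_power2[of k x] assms by (simp add: Tr_def)

text \<open>Transitivity of the trace: \<open>x + x ^ (2 ^ k)\<close> is the relative trace from the
  field with \<open>2 ^ (2 * k)\<close> elements to the one with \<open>2 ^ k\<close>.\<close>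

lemma Tr_double:
  fixes x :: "'a::field"
  assumes "CHAR('a) = 2"
  shows "Tr (2 * k) x = Tr k (x + x ^ (2 ^ k))"
  by (simp add: Tr_def mult_2 trace_sum_add_left trace_sum_add[OF assms])

text \<open>Here \<open>x\<close> is not fixed by the \<open>2 ^ k\<close>-th power, so
  \<open>x ^ 2\<close> and \<open>x\<close> need not have equal trace sums: the sum telescopes to
  \<open>x ^ (2 ^ k) + x\<close>, which is 1.\<close>

lemma Tr_Artin_Schreier:
  fixes x :: "'a::field"
  assumes char: "CHAR('a) = 2" and "x ^ (2 ^ k) = x + 1"
  shows "Tr k (x ^ 2 + x) = 1"
proof -
  have two: "y + y = 0" for y :: 'a
    using minus_CHAR_2[OF char, of y y] by simp
  have "trace_sum k (x ^ 2 + x) = trace_sum k (x ^ 2) + trace_sum k x + (x + x)"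
    unfolding trace_sum_add[OF char] two by simp
  also have "\<dots> = (trace_sum k (x ^ 2) + x) + (trace_sum k x + x)"
    by (simp only: ac_simps)
  also have "\<dots> = (trace_sum k x + trace_sum k x) + (x + x) + 1"
    unfolding trace_sum_power2 assms(2) by (simp only: ac_simps)
  also have "\<dots> = 1"
    by (simp only: two) simp
  finally show ?thesis
    by (simp add: Tr_def)
qed

text \<open>The trace sum is a polynomial of degree at most \<open>2 ^ (k - 1)\<close>, nonzero
  because only \<open>i = 0\<close> contributes to the coefficient of \<open>X\<close>. It has too
  few roots to vanish on all of \<open>K\<close>.\<close>

lemma exists_trace_sum_nonzero:
  fixes K :: "'a::field set"
  assumes "k > 0" "card K = 2 ^ k"
  obtains x where "x \<in> K" "trace_sum k x \<noteq> 0"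
proof -
  define p :: "'a poly" where "p = (\<Sum>i<k. monom 1 (2 ^ i))"
  have poly: "poly p x = trace_sum k x" for x
    by (simp add: p_def trace_sum_def poly_sum poly_monom)
  have "coeff p 1 = (\<Sum>i<k. if i = 0 then 1 else 0)"
    by (auto simp: p_def coeff_sum intro!: sum.cong)
  then have "coeff p 1 = 1"
    using assms(1) by simp
  then have "p \<noteq> 0"
    by auto
  have "degree p \<le> 2 ^ (k - 1)"
    unfolding p_def
    by (rule degree_sum_le) (use assms(1) in \<open>auto simp: degree_monom_eq\<close>)
  also have "\<dots> < (2 :: nat) ^ k"
    using assms(1) by simp
  finally have "card {x. poly p x = 0} < card K"
    using card_poly_roots_bound[OF \<open>p \<noteq> 0\<close>] assms(2) by simp
  then have "\<not> K \<subseteq> {x. poly p x = 0}"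
    using card_mono[OF poly_roots_finite[OF \<open>p \<noteq> 0\<close>]] by (meson not_le)
  then show thesis
    using that by (auto simp: poly)
qed

text \<open>Fermat's argument: multiplication by a nonzero \<open>x\<close> permutes
  \<open>K - {0}\<close>, so comparing the products of all nonzero elements gives
  \<open>x ^ card (K - {0}) = 1\<close>.\<close>

lemma subfield_power_card:
  fixes K :: "'a::field set"
  assumes "is_subfield K" "finite K" "x \<in> K"
  shows "x ^ card K = x"
proof (cases "x = 0")
  case False
  have "inverse x \<in> K"
    using assms(1,3) by (simp add: is_subfield_def)
  have "0 \<in> K"
    using assms(1) by (simp add: is_subfield_def)
  have "(\<Prod>y\<in>K - {0}. y) = (\<Prod>y\<in>K - {0}. x * y)"
    by (rule prod.reindex_bij_witness[of _ "\<lambda>y. x * y" "\<lambda>y. inverse x * y"])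
      (use assms(1,3) False \<open>inverse x \<in> K\<close> in \<open>auto simp: is_subfield_def\<close>)
  also have "\<dots> = x ^ card (K - {0}) * (\<Prod>y\<in>K - {0}. y)"
    by (simp add: prod.distrib)
  finally have "x ^ card (K - {0}) = 1"
    using assms(2) by (simp add: prod_zero_iff)
  then show ?thesis
    using card.remove[OF assms(2) \<open>0 \<in> K\<close>] by simp
next
  case True
  then show ?thesis
    using assms by (auto simp: is_subfield_def card_eq_0_iff power_0_left)
qed

section \<open>Conjugation \<open>x ^ (2 ^ m)\<close>, relative trace and norm over
  \<open>K\<close>\<close>

locale quadratic_extension =
  fixes m :: nat and K :: "'a::finite_field set"
  assumes m_pos: "m > 0"
    and card_UNIV: "card (UNIV :: 'a set) = (2 ^ m) ^ 2"
    and subfield: "is_subfield K"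
    and card_K: "card K = 2 ^ m"
begin

lemma char: "CHAR('a) = 2"
proof -
  have "prime CHAR('a)"
    by simp
  moreover have "CHAR('a) dvd (2 ^ m) ^ 2"
    using CHAR_dvd_CARD[where 'a = 'a] card_UNIV by simp
  ultimately show ?thesis
    by (metis prime_dvd_power primes_dvd_imp_eq two_is_prime_nat)
qed

lemma add_self: "x + x = (0 :: 'a)"
  using minus_CHAR_2[OF char, of x x] by simp

lemma add_self_left: "x + (x + y) = (y :: 'a)"
  by (simp add: add_self flip: add.assoc)

lemmas char2_simps = add_self add_self_left

lemma add_eq_0_iff_eq: "x + y = 0 \<longleftrightarrow> x = (y :: 'a)"
  using minus_CHAR_2[OF char, of x y] by (metis right_minus_eq)

lemma frob_add: "(x + y) ^ (2 ^ m) = x ^ (2 ^ m) + (y :: 'a) ^ (2 ^ m)"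
  by (rule freshmans_dream') (simp_all add: char)

lemma frob_frob: "(x ^ (2 ^ m)) ^ (2 ^ m) = (x :: 'a)"
  using finite_field_power_card_eq_same[of x] card_UNIV
  by (simp add: power2_eq_square flip: power_mult)

text \<open>All \<open>2 ^ m\<close> elements of \<open>K\<close> are roots of
  \<open>X ^ (2 ^ m) - X\<close>, whose degree leaves room for no others.\<close>

lemma K_iff: "x \<in> K \<longleftrightarrow> x ^ (2 ^ m) = x"
proof -
  define p :: "'a poly" where "p = monom 1 (2 ^ m) - monom 1 1"
  have "(2 :: nat) ^ m > 1"
    using m_pos by (intro one_less_power) auto
  then have "coeff p (2 ^ m) = 1"
    by (simp add: p_def)
  then have "p \<noteq> 0"
    by auto
  have "degree p \<le> 2 ^ m"
    unfolding p_def by (rule degree_diff_le) (auto simp: degree_monom_eq)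
  then have "card {x. poly p x = 0} \<le> card K"
    using card_poly_roots_bound[OF \<open>p \<noteq> 0\<close>] card_K by simp
  moreover have roots: "{x. poly p x = 0} = {x. x ^ (2 ^ m) = x}"
    by (simp add: p_def poly_monom)
  moreover have "K \<subseteq> {x. x ^ (2 ^ m) = x}"
    using subfield_power_card[OF subfield] by (auto simp: card_K)
  ultimately have "K = {x. x ^ (2 ^ m) = x}"
    by (intro card_seteq) auto
  then show ?thesis
    by blast
qed

lemma K_closed:
  "0 \<in> K" "1 \<in> K"
  "x \<in> K \<Longrightarrow> y \<in> K \<Longrightarrow> x + y \<in> K"
  "x \<in> K \<Longrightarrow> y \<in> K \<Longrightarrow> x * y \<in> K"
  "x \<in> K \<Longrightarrow> - x \<in> K"
  "x \<in> K \<Longrightarrow> inverse x \<in> K"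
  using subfield by (auto simp: is_subfield_def)

lemma K_power: "x \<in> K \<Longrightarrow> x ^ k \<in> K"
  by (induction k) (auto intro: K_closed)

lemma relative_trace_in_K: "x ^ (2 ^ m) + x \<in> K"
  by (simp add: K_iff frob_add frob_frob add.commute)

lemma norm_in_K: "x ^ (2 ^ m + 1) \<in> K"
  by (simp add: K_iff power_mult_distrib frob_frob mult.commute)

lemma Tr_add_K: "x \<in> K \<Longrightarrow> y \<in> K \<Longrightarrow> Tr m (x + y) = Tr m x + Tr m y"
  by (simp add: Tr_add char K_iff)

text \<open>The relative trace is \<open>K\<close>-linear and takes a nonzero value \<open>d\<close>
  at any \<open>z\<close> outside \<open>K\<close>; rescaling \<open>z\<close> by
  \<open>c * inverse d\<close> reaches \<open>c\<close>.\<close>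

lemma exists_relative_trace:
  assumes "c \<in> K"
  obtains x where "x ^ (2 ^ m) + x = c"
proof -
  have "(2 :: nat) ^ m < (2 ^ m) ^ 2"
    using m_pos one_less_power[of "2 :: nat" m] by (simp add: power2_eq_square)
  then have "K \<noteq> UNIV"
    using card_UNIV card_K by auto
  then obtain z where "z \<notin> K"
    by blast
  define d where "d = z ^ (2 ^ m) + z"
  have "d \<noteq> 0"
    using \<open>z \<notin> K\<close> by (simp add: d_def add_eq_0_iff_eq K_iff)
  have "c * inverse d \<in> K"
    using assms relative_trace_in_K by (simp add: d_def K_closed)
  then have "(c * inverse d) ^ (2 ^ m) = c * inverse d"
    by (simp only: K_iff)
  then have "(c * inverse d * z) ^ (2 ^ m) + c * inverse d * z = c * inverse d * d"
    by (simp only: power_mult_distrib[of "c * inverse d" z]) (simp add: d_def algebra_simps)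
  with \<open>d \<noteq> 0\<close> show thesis
    by (intro that[of "c * inverse d * z"]) simp
qed

lemma square_eq_iff: "x ^ 2 = y ^ 2 \<longleftrightarrow> x = (y :: 'a)"
proof -
  have "(x + y) ^ 2 = x ^ 2 + y ^ 2"
    by (rule freshmans_dream) (simp_all add: char)
  then show ?thesis
    by (metis add_eq_0_iff_eq power2_eq_square mult_eq_0_iff)
qed

lemma sqrt_in_K:
  assumes "a \<in> K"
  shows "sqrt_in K a \<in> K" "sqrt_in K a ^ 2 = a"
proof -
  \<comment> \<open>Since \<open>a ^ (2 ^ m) = a\<close>, stopping one squaring short yields a root;
    \<open>m > 0\<close> makes \<open>Suc (m - 1)\<close> equal to \<open>m\<close>. Uniqueness is
    injectivity of squaring.\<close>
  have "(a ^ (2 ^ (m - 1))) ^ 2 = a ^ (2 ^ Suc (m - 1))"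
    by (simp add: mult.commute flip: power_mult)
  also have "\<dots> = a"
    using assms m_pos by (simp add: K_iff)
  finally have "\<exists>!r. r \<in> K \<and> r ^ 2 = a"
    using K_power[OF assms] by (metis square_eq_iff)
  then have "sqrt_in K a \<in> K \<and> sqrt_in K a ^ 2 = a"
    unfolding sqrt_in_def by (rule theI')
  then show "sqrt_in K a \<in> K" "sqrt_in K a ^ 2 = a"
    by auto
qed

section \<open>The Walsh sum over one fibre of the relative trace\<close>

lemma sum_sign_Tr:
  assumes "d \<in> K"
  shows "(\<Sum>y\<in>K. sign (Tr m (d * y))) = (if d = 0 then 2 ^ m else 0)"
proof (cases "d = 0")
  case True
  then show ?thesis
    by (simp add: Tr_0 sign_def card_K)
next
  case False
  obtain z where z: "z \<in> K" "trace_sum m z \<noteq> 0"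
    using exists_trace_sum_nonzero[OF m_pos card_K] .
  have "(\<Sum>y\<in>K. sign (Tr m (d * y))) = 0"
  proof (rule sum_character_eq_0)
    \<comment> \<open>Dividing by \<open>d\<close> cancels the factor inside the character, which
      therefore takes the value -1 at this witness.\<close>
    show "inverse d * z \<in> K"
      using assms z by (simp add: K_closed)
    show "sign (Tr m (d * (inverse d * z))) \<noteq> 1"
      using False z by (simp add: Tr_def sign_def flip: mult.assoc)
    show "sign (Tr m (d * (x + y))) = sign (Tr m (d * x)) * sign (Tr m (d * y))"
      if "x \<in> K" "y \<in> K" for x y
      using that assms by (simp only: distrib_left Tr_add_K K_closed sign_add)
  qed (auto simp: K_closed)
  with False show ?thesis
    by simp
qed

text \<open>The relative trace is additive with kernel \<open>K\<close>, and in characteristic 2 the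
  difference of two points of a fibre is their sum.\<close>

lemma fibre_eq:
  assumes "z ^ (2 ^ m) + z = c"
  shows "{x. x ^ (2 ^ m) + x = c} = (\<lambda>y. z + y) ` K"
proof (intro equalityI subsetI)
  fix x assume "x \<in> {x. x ^ (2 ^ m) + x = c}"
  then have "(x ^ (2 ^ m) + x) + (z ^ (2 ^ m) + z) = 0"
    using assms add_self[of c] by simp
  then have "(z + x) ^ (2 ^ m) + (z + x) = 0"
    by (simp only: frob_add ac_simps)
  then have "z + x \<in> K"
    by (simp only: add_eq_0_iff_eq K_iff)
  moreover have "x = z + (z + x)"
    by (simp add: char2_simps)
  ultimately show "x \<in> (\<lambda>y. z + y) ` K"
    by blast
next
  fix x assume "x \<in> (\<lambda>y. z + y) ` K"
  then obtain y where y: "y ^ (2 ^ m) = y" "x = z + y"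
    by (auto simp: K_iff)
  have "x ^ (2 ^ m) + x = (z ^ (2 ^ m) + z) + (y + y)"
    unfolding y(2) frob_add y(1) by (simp only: ac_simps)
  then show "x \<in> {x. x ^ (2 ^ m) + x = c}"
    unfolding add_self assms by simp
qed

text \<open>For \<open>y\<close> in \<open>K\<close> the norm of \<open>z + y\<close> is that of
  \<open>z\<close> plus \<open>c * y + y ^ 2\<close>. The quadratic term \<open>a * y ^ 2\<close> is
  the square of \<open>sqrt_in K a * y\<close> and has the same trace as it, so the dependence on
  \<open>y\<close> is additive.\<close>

lemma Tr_norm_translate:
  assumes a: "a \<in> K" and c: "c \<in> K" and z: "z ^ (2 ^ m) + z = c" and y: "y \<in> K"
  shows "Tr m (a * (z + y) ^ (2 ^ m + 1)) + Tr (2 * m) (b * (z + y)) =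
    Tr m (a * z ^ (2 ^ m + 1)) + Tr (2 * m) (b * z)
      + Tr m ((a * c + sqrt_in K a + (b ^ (2 ^ m) + b)) * y)"
proof -
  define s where "s = sqrt_in K a"
  have s: "s \<in> K" "s ^ 2 = a"
    using sqrt_in_K[OF a] by (simp_all add: s_def)
  have y_frob: "y ^ (2 ^ m) = y"
    using y by (simp add: K_iff)
  have "a * (z + y) ^ (2 ^ m + 1) = a * z ^ (2 ^ m + 1) + (a * c * y + (s * y) ^ 2)"
    unfolding z[symmetric] s(2)[symmetric]
    by (simp add: frob_add y_frob algebra_simps power2_eq_square)
  then have "Tr m (a * (z + y) ^ (2 ^ m + 1)) =
      Tr m (a * z ^ (2 ^ m + 1)) + (Tr m (a * c * y) + Tr m ((s * y) ^ 2))"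
    using a c y s norm_in_K[of z] by (simp only: Tr_add_K K_closed K_power)
  also have "Tr m ((s * y) ^ 2) = Tr m (s * y)"
    using K_closed(4)[OF s(1) y] by (simp add: Tr_power2 K_iff)
  finally have 1: "Tr m (a * (z + y) ^ (2 ^ m + 1)) =
      Tr m (a * z ^ (2 ^ m + 1)) + (Tr m (a * c * y) + Tr m (s * y))" .
  \<comment> \<open>The relative trace of \<open>b * (z + y)\<close>, prepared for
    \<open>Tr_double\<close>; conjugation fixes \<open>y\<close>, so \<open>b ^ (2 ^ m) + b\<close>
    factors out.\<close>
  have "b * (z + y) + (b * (z + y)) ^ (2 ^ m) =
      ((b * z) ^ (2 ^ m) + b * z) + (b ^ (2 ^ m) + b) * y"
    by (simp add: power_mult_distrib frob_add y_frob algebra_simps)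
  then have 2: "Tr (2 * m) (b * (z + y)) = Tr (2 * m) (b * z) + Tr m ((b ^ (2 ^ m) + b) * y)"
    using Tr_add_K[OF relative_trace_in_K K_closed(4)[OF relative_trace_in_K y], of "b * z" b]
    by (simp add: Tr_double[OF char] add.commute)
  have 3: "Tr m ((a * c + s + (b ^ (2 ^ m) + b)) * y) =
      Tr m (a * c * y) + Tr m (s * y) + Tr m ((b ^ (2 ^ m) + b) * y)"
    using a c y s relative_trace_in_K[of b] 
    by (simp only: distrib_right[of "a * c + s"] distrib_right[of "a * c"] Tr_add_K K_closed)
  show ?thesis
    unfolding 1 2 s_def[symmetric] 3 by (simp only: ac_simps)
qed

lemma fibre_sum:
  assumes a: "a \<in> K" and c: "c \<in> K" and z: "z ^ (2 ^ m) + z = c"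
  shows "(\<Sum>x | x ^ (2 ^ m) + x = c. sign (Tr m (a * x ^ (2 ^ m + 1)) + Tr (2 * m) (b * x))) =
    (if b ^ (2 ^ m) + b = a * c + sqrt_in K a
     then 2 ^ m * sign (Tr m (a * z ^ (2 ^ m + 1)) + Tr (2 * m) (b * z)) else 0)"
proof -
  define d where "d = a * c + sqrt_in K a + (b ^ (2 ^ m) + b)"
  have "d \<in> K"
    using a c sqrt_in_K[OF a] relative_trace_in_K by (simp add: d_def K_closed)
  have d0: "d = 0 \<longleftrightarrow> b ^ (2 ^ m) + b = a * c + sqrt_in K a"
    unfolding d_def by (auto simp: add_eq_0_iff_eq)
  have "(\<Sum>x | x ^ (2 ^ m) + x = c. sign (Tr m (a * x ^ (2 ^ m + 1)) + Tr (2 * m) (b * x))) =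
      (\<Sum>y\<in>K. sign (Tr m (a * (z + y) ^ (2 ^ m + 1)) + Tr (2 * m) (b * (z + y))))"
    unfolding fibre_eq[OF z] by (subst sum.reindex) (auto simp: inj_on_def)
  also have "\<dots> = sign (Tr m (a * z ^ (2 ^ m + 1)) + Tr (2 * m) (b * z)) * (\<Sum>y\<in>K. sign (Tr m (d * y)))"
    unfolding sum_distrib_left d_def
    by (intro sum.cong refl) (simp only: Tr_norm_translate[OF a c z] sign_add)
  finally show ?thesis
    by (simp add: sum_sign_Tr[OF \<open>d \<in> K\<close>] d0)
qed

text \<open>
  The two traces in \<open>b\<close> and \<open>z\<close> and the one on the right add up to \<open>Tr\<close> of the norm of
  \<open>v = (a z + b\<^sup>q) / a\<^bsup>1/2\<^esup>\<close>; since \<open>v\<^sup>q + v = 1\<close>, this norm is \<open>v\<^sup>2 + v\<close>, whose trace is 1.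
\<close>

lemma Tr_norm_critical_fibre:
  assumes a: "a \<in> K" "a \<noteq> 0" and z: "z ^ (2 ^ m) + z = c"
    and b: "b ^ (2 ^ m) + b = a * c + sqrt_in K a"
  shows "Tr m (a * z ^ (2 ^ m + 1)) + Tr (2 * m) (b * z) = Tr m (inverse a * b ^ (2 ^ m + 1)) + 1"
proof -
  define s where "s = sqrt_in K a"
  have s: "s \<in> K" "s ^ 2 = a"
    using sqrt_in_K[OF a(1)] by (simp_all add: s_def)
  have "s \<noteq> 0"
    using s a by auto
  define v where "v = inverse s * (a * z + b ^ (2 ^ m))"
  have inv: "inverse s \<in> K"
    using s by (simp add: K_closed)
  have v_frob: "v ^ (2 ^ m) = inverse s * (a * z ^ (2 ^ m) + b)"
    using inv a(1) unfolding v_def by (simp only: power_mult_distrib frob_add frob_frob K_iff)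
  have "v ^ (2 ^ m) + v = inverse s * (a * (z ^ (2 ^ m) + z) + (b ^ (2 ^ m) + b))"
    unfolding v_frob by (simp add: v_def algebra_simps)
  \<comment> \<open>By the condition on \<open>b\<close>, the two copies of \<open>a * c\<close>
    cancel and only \<open>s\<close> remains.\<close>
  also have "\<dots> = inverse s * s"
    unfolding z b s_def[symmetric] by (simp add: char2_simps)
  finally have "v ^ (2 ^ m) + v = 1"
    using \<open>s \<noteq> 0\<close> by simp
  then have v: "v ^ (2 ^ m) = v + 1"
    by (metis add.commute add_self_left)
  have "v ^ 2 + v = v ^ (2 ^ m) * v"
    unfolding v by (simp add: algebra_simps power2_eq_square)
  also have "\<dots> = inverse a * ((a * z ^ (2 ^ m) + b) * (a * z + b ^ (2 ^ m)))"
    unfolding v_frob by (simp add: v_def flip: s(2)) (simp add: power2_eq_square)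
  also have "\<dots> = a * z ^ (2 ^ m + 1) + ((b * z) ^ (2 ^ m) + b * z) + inverse a * b ^ (2 ^ m + 1)"
    using a(2) by (simp add: power_mult_distrib field_simps)
  finally have "Tr m (v ^ 2 + v) = Tr m (a * z ^ (2 ^ m + 1)) + Tr m ((b * z) ^ (2 ^ m) + b * z)
      + Tr m (inverse a * b ^ (2 ^ m + 1))"
    using a(1) norm_in_K[of z] norm_in_K[of b] relative_trace_in_K[of "b * z"]
    by (simp only: Tr_add_K K_closed)
  moreover have "Tr m (v ^ 2 + v) = 1"
    by (rule Tr_Artin_Schreier[OF char v])
  ultimately have "Tr m (a * z ^ (2 ^ m + 1)) + Tr (2 * m) (b * z)
      + Tr m (inverse a * b ^ (2 ^ m + 1)) = 1"
    by (simp add: Tr_double[OF char] add.commute)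
  then show ?thesis
    by (cases "Tr m (inverse a * b ^ (2 ^ m + 1))"; 
        cases "Tr m (a * z ^ (2 ^ m + 1)) + Tr (2 * m) (b * z)") simp_all
qed

section \<open>Indexing \<open>K\<close> by the powers of a primitive element\<close>

lemma bij_betw_epow:
  assumes "primitive_element K \<xi>"
  shows "bij_betw (epow \<xi>) (index_set (2 ^ m)) K"
proof -
  have powers: "K - {0} = range (\<lambda>i. \<xi> ^ i)"
    using assms by (simp add: primitive_element_def)
  then have "\<xi> ^ 1 \<in> K - {0}"
    by blast
  then have \<xi>: "\<xi> \<in> K" "\<xi> \<noteq> 0"
    by simp_all
  have "\<xi> * \<xi> ^ (2 ^ m - 1) = \<xi> * 1"
    using \<xi>(1) by (simp add: K_iff flip: power_Suc)
  then have one: "\<xi> ^ (2 ^ m - 1) = 1"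
    using \<xi>(2) by simp
  \<comment> \<open>Exponents reduce modulo \<open>2 ^ m - 1\<close>, which is positive as
    \<open>m > 0\<close>. With \<open>\<infinity>\<close> giving 0, the indices then cover
    \<open>K\<close>, and injectivity follows from equal cardinalities.\<close>
  have "\<xi> ^ i \<in> (\<lambda>i. \<xi> ^ i) ` {..<2 ^ m - 1}" for i
  proof -
    have "\<xi> ^ i = (\<xi> ^ (2 ^ m - 1)) ^ (i div (2 ^ m - 1)) * \<xi> ^ (i mod (2 ^ m - 1))"
      by (simp flip: power_mult power_add)
    then have "\<xi> ^ i = \<xi> ^ (i mod (2 ^ m - 1))"
      unfolding one by simp
    moreover have "i mod (2 ^ m - 1) \<in> {..<2 ^ m - 1}"
      using one_less_power[of "2 :: nat" m] m_pos by simp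
    ultimately show ?thesis
      by blast
  qed
  then have "K - {0} = (\<lambda>i. \<xi> ^ i) ` {..<2 ^ m - 1}"
    unfolding powers by blast
  then have "epow \<xi> ` index_set (2 ^ m) = insert 0 (K - {0})"
    by (simp add: index_set_def epow_def image_image)
  also have "\<dots> = K"
    using K_closed(1) by blast
  finally have image: "epow \<xi> ` index_set (2 ^ m) = K" .
  have "card (index_set (2 ^ m)) = card K"
    unfolding index_set_def card_K
    by (subst card_insert_disjoint) (auto simp: card_image inj_on_def)
  moreover have "finite (index_set (2 ^ m))"
    by (simp add: index_set_def)
  ultimately show ?thesis
    using image by (simp add: bij_betw_def eq_card_imp_inj_on)
qed

end

section \<open>Assembling the Walsh coefficients from the fibres\<close>

theorem theorem4p2:
  fixes m q :: nat
    and K :: "'a::finite_field set"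
    and \<xi> :: 'a
    and \<alpha> :: "enat \<Rightarrow> 'a"
    and f :: "'a \<Rightarrow> bit"
  assumes "m > 0"
    and "q = 2 ^ m"
    and "card (UNIV :: 'a set) = q ^ 2"
    and "is_subfield K" and "card K = q"
    and "primitive_element K \<xi>"
    and "\<And>i. i \<in> index_set q \<Longrightarrow> \<alpha> i \<in> K"
    and "\<And>i x. i \<in> index_set q \<Longrightarrow> x \<in> N_set q \<xi> i \<Longrightarrow> f x = Tr m (\<alpha> i * x ^ (q + 1))"
    and "(\<lambda>i. (\<alpha> i) ^ 2 * epow \<xi> (2 * i) + \<alpha> i) ` index_set q = K"
  shows "bent m f \<and>
    (\<forall>b. (\<exists>!t. t \<in> index_set q \<and> b ^ q + b = \<alpha> t * epow \<xi> t + sqrt_in K (\<alpha> t)) \<and>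
         (\<forall>t \<in> index_set q. b ^ q + b = \<alpha> t * epow \<xi> t + sqrt_in K (\<alpha> t) \<longrightarrow>
            walsh (2 * m) f b = int q * sign (phi m \<xi> \<alpha> t b)))"
proof -
  interpret quadratic_extension m K
    using assms(1-5) by unfold_locales simp_all
  note q = assms(2) and \<alpha>_K = assms(7) and f = assms(8)
  let ?I = "index_set q"
  have bij: "bij_betw (epow \<xi>) ?I K"
    using bij_betw_epow[OF assms(6)] by (simp add: q)
  have fin: "finite ?I"
    by (simp add: index_set_def)
  have epow_K: "epow \<xi> i \<in> K" if "i \<in> ?I" for i
    using bij that by (rule bij_betw_apply)
  \<comment> \<open>The index \<open>2 * i\<close> is taken in \<open>enat\<close>, without
    reduction; at \<open>\<infinity>\<close> both sides are 0.\<close>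
  have epow_double: "epow \<xi> (2 * i) = epow \<xi> i ^ 2" for i
    by (cases i) (simp_all add: epow_def power_even_eq power_mult mult.commute numeral_eq_enat)
  define g where "g i = \<alpha> i * epow \<xi> i + sqrt_in K (\<alpha> i)" for i
  have g_K: "g i \<in> K" if "i \<in> ?I" for i
    using that by (simp add: g_def K_closed \<alpha>_K epow_K sqrt_in_K)
  have g_square: "g i ^ 2 = \<alpha> i ^ 2 * epow \<xi> (2 * i) + \<alpha> i" if "i \<in> ?I" for i
  proof -
    have "g i ^ 2 = (\<alpha> i * epow \<xi> i) ^ 2 + sqrt_in K (\<alpha> i) ^ 2"
      unfolding g_def by (rule freshmans_dream) (simp_all add: char)
    then show ?thesis
      using sqrt_in_K[OF \<alpha>_K[OF that]] by (simp add: power_mult_distrib epow_double)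
  qed
  have "(\<lambda>x. x ^ 2) ` g ` ?I = K"
    using assms(9) by (simp add: image_image g_square)
  \<comment> \<open>A set whose squares fill \<open>K\<close> has at least \<open>card K\<close>
    elements, so \<open>g\<close> maps the indices onto \<open>K\<close>; equal cardinalities make
    it injective.\<close>
  then have "card K \<le> card (g ` ?I)"
    using card_image_le[of "g ` ?I" "\<lambda>x. x ^ 2"] fin by simp
  then have g_image: "g ` ?I = K"
    using g_K by (intro card_seteq) auto
  moreover have "card ?I = card K"
    using bij by (rule bij_betw_same_card)
  ultimately have g_inj: "inj_on g ?I"
    using fin by (simp add: eq_card_imp_inj_on)
  have walsh_t: "walsh (2 * m) f b = int q * sign (phi m \<xi> \<alpha> t b)"
    if t: "t \<in> ?I" and bt: "b ^ q + b = g t" for b t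
  proof -
    have fibre: "(\<Sum>x\<in>N_set q \<xi> i. sign (f x + Tr (2 * m) (b * x))) =
        (if i = t then int q * sign (phi m \<xi> \<alpha> t b) else 0)" if i: "i \<in> ?I" for i
    proof -
      obtain z where z: "z ^ (2 ^ m) + z = epow \<xi> i"
        using exists_relative_trace[OF epow_K[OF i]] .
      have "b ^ q + b = g i \<longleftrightarrow> i = t"
        using bt i t g_inj by (auto dest: inj_onD)
      then have "b ^ (2 ^ m) + b = \<alpha> i * epow \<xi> i + sqrt_in K (\<alpha> i) \<longleftrightarrow> i = t"
        by (simp add: q g_def)
      moreover have "(\<Sum>x\<in>N_set q \<xi> i. sign (f x + Tr (2 * m) (b * x))) =
        (\<Sum>x | x ^ (2 ^ m) + x = epow \<xi> i.
          sign (Tr m (\<alpha> i * x ^ (2 ^ m + 1)) + Tr (2 * m) (b * x)))"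
        using f[OF i] by (intro sum.cong) (auto simp: N_set_def q)
      moreover have "Tr m (\<alpha> i * z ^ (2 ^ m + 1)) + Tr (2 * m) (b * z) = phi m \<xi> \<alpha> i b"
        if it: "i = t"
      proof (cases "\<alpha> i = 0")
        \<comment> \<open>Now \<open>g t = 0\<close>, so conjugation fixes \<open>b\<close> and the
          relative trace of \<open>b * z\<close> is \<open>b\<close> times that of
          \<open>z\<close>.\<close>
        case True
        then have "sqrt_in K (\<alpha> i) = 0"
          using sqrt_in_K(2)[OF \<alpha>_K[OF i]] by simp
        with True bt it have "b ^ (2 ^ m) = b"
          by (simp add: q g_def add_eq_0_iff_eq)
        then have "b * z + (b * z) ^ (2 ^ m) = epow \<xi> i * b"
          unfolding z[symmetric] by (simp add: power_mult_distrib algebra_simps)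
        with True show ?thesis
          by (simp add: Tr_0 phi_def Tr_double[OF char])
      next
        case False
        have "b ^ (2 ^ m) + b = \<alpha> i * epow \<xi> i + sqrt_in K (\<alpha> i)"
          using bt it by (simp add: q g_def)
        from Tr_norm_critical_fibre[OF \<alpha>_K[OF i] False z this] False show ?thesis
          by (simp add: phi_def)
      qed
      ultimately show ?thesis
        using fibre_sum[OF \<alpha>_K[OF i] epow_K[OF i] z, of b] by (simp add: q)
    qed
    \<comment> \<open>Every relative trace lies in \<open>K\<close> and is therefore some
      \<open>epow \<xi> i\<close>; injectivity of \<open>epow \<xi>\<close> makes the fibres
      disjoint below.\<close>
    have "(\<Union>i\<in>?I. N_set q \<xi> i) = UNIV"
      using bij relative_trace_in_K unfolding bij_betw_def N_set_def q by blast
    then have "walsh (2 * m) f b = (\<Sum>x\<in>(\<Union>i\<in>?I. N_set q \<xi> i). sign (f x + Tr (2 * m) (b * x)))"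
      by (simp add: walsh_def)
    also have "\<dots> = (\<Sum>i\<in>?I. \<Sum>x\<in>N_set q \<xi> i. sign (f x + Tr (2 * m) (b * x)))"
    proof (rule sum.UNION_disjoint)
      show "\<forall>i\<in>?I. \<forall>j\<in>?I. i \<noteq> j \<longrightarrow> N_set q \<xi> i \<inter> N_set q \<xi> j = {}"
        using bij by (auto simp: bij_betw_def N_set_def dest: inj_onD)
    qed (use fin in auto)
    also have "\<dots> = (\<Sum>i\<in>?I. if i = t then int q * sign (phi m \<xi> \<alpha> t b) else 0)"
      by (intro sum.cong refl fibre)
    also have "\<dots> = int q * sign (phi m \<xi> \<alpha> t b)"
      using t fin by simp
    finally show ?thesis .
  qed
  have ex1: "\<exists>!t. t \<in> ?I \<and> b ^ q + b = g t" for b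
  proof -
    have "b ^ q + b \<in> g ` ?I"
      using relative_trace_in_K[of b] g_image by (simp only: q)
    then show ?thesis
      using g_inj by (metis (no_types, lifting) imageE inj_onD)
  qed
  have "bent m f"
    unfolding bent_def
  proof
    fix b
    obtain t where "t \<in> ?I" "b ^ q + b = g t"
      using ex1[of b] by blast
    then show "\<bar>walsh (2 * m) f b\<bar> = 2 ^ m"
      by (simp add: walsh_t abs_mult q sign_def)
  qed
  with ex1 walsh_t show ?thesis
    unfolding g_def by blast
qed

end
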